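(* Every finitely generated centrally endo-AIP $\mathbb{Z}$-module is torsion-free or semisimple.
   Context: For a module $M$ with $S=\mathrm{End}(M)$ and $N\le M$, $l_S(N)=\{\phi\in S:\phi(N)=0\}$. An ideal $I$ of $S$ is centrally s-unital if for every $a\in I$ there is $z\in I$ central in $S$ with $az=a$. $M$ is centrally endo-AIP if $l_S(N)$ is a centrally s-unital ideal of $S$ for every fully invariant submodule $N$ of $M$. *)

theory Defs
  imports Main "HOL.Modules"
begin

text \<open>A Z-module is modelled as an abelian group type 'b together with a
scalar multiplication s :: int => 'b => 'b satisfying the module axioms
(the library locale module). The whole type is the module M.
End(M) = the Z-linear maps 'b => 'b (module_hom s s), with multiplication
given by composition.\<close>

definition endo :: "(int \<Rightarrow> 'b::ab_group_add \<Rightarrow> 'b) \<Rightarrow> ('b \<Rightarrow> 'b) set" where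
  "endo s = {f. module_hom s s f}"

definition fully_invariant :: "(int \<Rightarrow> 'b::ab_group_add \<Rightarrow> 'b) \<Rightarrow> 'b set \<Rightarrow> bool" where
  "fully_invariant s N \<longleftrightarrow> module.subspace s N \<and> (\<forall>f \<in> endo s. f ` N \<subseteq> N)"

text \<open>left annihilator l_S(N)\<close>
definition lann :: "(int \<Rightarrow> 'b::ab_group_add \<Rightarrow> 'b) \<Rightarrow> 'b set \<Rightarrow> ('b \<Rightarrow> 'b) set" where
  "lann s N = {\<phi> \<in> endo s. \<forall>x \<in> N. \<phi> x = 0}"

definition endo_ideal :: "(int \<Rightarrow> 'b::ab_group_add \<Rightarrow> 'b) \<Rightarrow> ('b \<Rightarrow> 'b) set \<Rightarrow> bool" where
  "endo_ideal s I \<longleftrightarrow> I \<subseteq> endo s \<and> (\<lambda>x. 0) \<in> I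
     \<and> (\<forall>a \<in> I. \<forall>b \<in> I. (\<lambda>x. a x - b x) \<in> I)
     \<and> (\<forall>a \<in> I. \<forall>t \<in> endo s. t \<circ> a \<in> I \<and> a \<circ> t \<in> I)"

definition endo_central :: "(int \<Rightarrow> 'b::ab_group_add \<Rightarrow> 'b) \<Rightarrow> ('b \<Rightarrow> 'b) \<Rightarrow> bool" where
  "endo_central s z \<longleftrightarrow> z \<in> endo s \<and> (\<forall>t \<in> endo s. z \<circ> t = t \<circ> z)"

definition centrally_s_unital :: "(int \<Rightarrow> 'b::ab_group_add \<Rightarrow> 'b) \<Rightarrow> ('b \<Rightarrow> 'b) set \<Rightarrow> bool" where
  "centrally_s_unital s I \<longleftrightarrow> endo_ideal s I \<and>
     (\<forall>a \<in> I. \<exists>z \<in> I. endo_central s z \<and> a \<circ> z = a)"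

definition centrally_endo_AIP :: "(int \<Rightarrow> 'b::ab_group_add \<Rightarrow> 'b) \<Rightarrow> bool" where
  "centrally_endo_AIP s \<longleftrightarrow> (\<forall>N. fully_invariant s N \<longrightarrow> centrally_s_unital s (lann s N))"

definition fin_gen :: "(int \<Rightarrow> 'b::ab_group_add \<Rightarrow> 'b) \<Rightarrow> bool" where
  "fin_gen s \<longleftrightarrow> (\<exists>F. finite F \<and> module.span s F = UNIV)"

definition torsion_free :: "(int \<Rightarrow> 'b::ab_group_add \<Rightarrow> 'b) \<Rightarrow> bool" where
  "torsion_free s \<longleftrightarrow> (\<forall>r x. r \<noteq> 0 \<longrightarrow> s r x = 0 \<longrightarrow> x = 0)"

text \<open>semisimple: every submodule is a direct summand\<close>
definition semisimple :: "(int \<Rightarrow> 'b::ab_group_add \<Rightarrow> 'b) \<Rightarrow> bool" where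
  "semisimple s \<longleftrightarrow> (\<forall>N. module.subspace s N \<longrightarrow>
     (\<exists>K. module.subspace s K \<and> N \<inter> K = {0} \<and> {n + k | n k. n \<in> N \<and> k \<in> K} = UNIV))"

end

theory Submission
  imports Defs "HOL-Computational_Algebra.Primes"
begin

(* Suppose M is not torsion-free, so some t \<noteq> 0 has p t = 0 for a prime p.
   Multiplication by p lies in the annihilator of N = ker p, so the AIP property gives a
   central z vanishing on N with p z = p; such a z is idempotent.  If some q = z y were
   not in pM, a maximal submodule L \<supseteq> pM avoiding q would make M/L cyclic of order p,
   generated by q, and M \<rightarrow> M/L \<cong> Z t would be an endomorphism g with g q = t; by
   centrality t = g (z y) = z (g y) \<in> z (Z t) = 0.  Hence zM = p zM, so by Nakayama the
   finitely generated module zM is killed by some a \<equiv> 1 mod p, and then p a kills M.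
   Applying AIP to ker n also gives n^2 x = 0 \<Longrightarrow> n x = 0.  In such a module every element
   outside a submodule L can be moved to an element of prime order outside L, which shows
   that a submodule K maximal with K \<inter> N = 0 is a complement of N. *)

lemma (in module) subspace_Union_chain:
  assumes "C \<noteq> {}" "\<And>X. X \<in> C \<Longrightarrow> subspace X" "\<And>X Y. X \<in> C \<Longrightarrow> Y \<in> C \<Longrightarrow> X \<subseteq> Y \<or> Y \<subseteq> X"
  shows "subspace (\<Union>C)"
proof (rule subspaceI)
  show "0 \<in> \<Union>C"
    using assms(1,2) subspace_0 by blast
next
  fix x y assume "x \<in> \<Union>C" "y \<in> \<Union>C"
  then obtain X Y where "X \<in> C" "Y \<in> C" "x \<in> X" "y \<in> Y" by blast
  with assms(2,3) show "x + y \<in> \<Union>C"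
    by (metis UnionI subsetD subspace_add)
next
  fix c x assume "x \<in> \<Union>C"
  then show "c *s x \<in> \<Union>C"
    using assms(2) subspace_scale by blast
qed

lemma (in module) exists_maximal_subspace:
  assumes "subspace L\<^sub>0" "L\<^sub>0 \<inter> A \<subseteq> B"
  obtains L where "subspace L" "L\<^sub>0 \<subseteq> L" "L \<inter> A \<subseteq> B"
    "\<And>y. y \<notin> L \<Longrightarrow> \<not> span (insert y L) \<inter> A \<subseteq> B"
proof -
  define \<A> where "\<A> = {L. subspace L \<and> L\<^sub>0 \<subseteq> L \<and> L \<inter> A \<subseteq> B}"
  have "\<Union>\<C> \<in> \<A>" if "\<C> \<noteq> {}" "subset.chain \<A> \<C>" for \<C>
    using that subspace_Union_chain[of \<C>] unfolding \<A>_def subset_chain_def by blast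
  moreover have "L\<^sub>0 \<in> \<A>"
    using assms unfolding \<A>_def by blast
  ultimately obtain L where L: "L \<in> \<A>" "\<And>X. X \<in> \<A> \<Longrightarrow> L \<subseteq> X \<Longrightarrow> X = L"
    using subset_Zorn_nonempty[of \<A>] by blast
  have "\<not> span (insert y L) \<inter> A \<subseteq> B" if "y \<notin> L" for y
  proof
    assume "span (insert y L) \<inter> A \<subseteq> B"
    moreover have "L \<subseteq> span (insert y L)"
      by (meson span_superset subset_insertI subset_trans)
    ultimately have "span (insert y L) = L"
      using L unfolding \<A>_def by blast
    then show False
      using that span_base[of y "insert y L"] by simp
  qed
  with L(1) that show ?thesis
    unfolding \<A>_def by blast
qed

locale int_module = module scale for scale :: "int \<Rightarrow> 'b::ab_group_add \<Rightarrow> 'b" (infixr \<open>*s\<close> 75)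
begin

lemma mem_subspace_if_coprime_scales:
  assumes "subspace L" "coprime a b" "a *s x \<in> L" "b *s x \<in> L"
  shows "x \<in> L"
proof -
  obtain u v where "u * a + v * b = 1"
    using bezout_int[of a b] assms(2) by (metis coprime_iff_gcd_eq_1)
  then have "x = u *s (a *s x) + v *s (b *s x)"
    by (metis scale_left_distrib scale_one scale_scale)
  then show ?thesis
    using assms by (metis subspace_add subspace_scale)
qed

lemma exists_endo_of_cyclic_quotient:
  assumes L: "subspace L"
    and cyclic: "\<And>y. \<exists>j. y - j *s q \<in> L"
    and ann: "\<And>j. j *s q \<in> L \<Longrightarrow> j *s t = 0"
  obtains g where "g \<in> endo scale" "g q = t" "\<And>y. \<exists>j. g y = j *s t"
proof -
  define \<phi> where "\<phi> y = (SOME j. y - j *s q \<in> L)" for y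
  have \<phi>: "y - \<phi> y *s q \<in> L" for y
    unfolding \<phi>_def using cyclic by (rule someI_ex)
  have \<phi>_unique: "\<phi> y *s t = j *s t" if "y - j *s q \<in> L" for y j
  proof -
    have "(y - j *s q) - (y - \<phi> y *s q) \<in> L"
      using that \<phi> L subspace_diff by blast
    then have "(\<phi> y - j) *s t = 0"
      by (intro ann) (simp add: scale_left_diff_distrib)
    then show ?thesis
      by (simp add: scale_left_diff_distrib)
  qed
  define g where "g y = \<phi> y *s t" for y
  have "g (x + y) = g x + g y" for x y
  proof -
    have "(x - \<phi> x *s q) + (y - \<phi> y *s q) \<in> L"
      using \<phi> L subspace_add by blast
    then have "g (x + y) = (\<phi> x + \<phi> y) *s t"
      unfolding g_def by (intro \<phi>_unique) (simp add: scale_left_distrib algebra_simps)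
    then show ?thesis
      by (simp add: g_def scale_left_distrib)
  qed
  moreover have "g (c *s x) = c *s g x" for c x
  proof -
    have "c *s (x - \<phi> x *s q) \<in> L"
      using \<phi> L subspace_scale by blast
    then show ?thesis
      unfolding g_def by (subst \<phi>_unique[of _ "c * \<phi> x"]) (simp_all add: scale_right_diff_distrib)
  qed
  ultimately have "g \<in> endo scale"
    unfolding endo_def by (simp add: module_hom_iff module_axioms)
  moreover have "g q = t"
    using \<phi>_unique[of q 1] subspace_0[OF L] by (simp add: g_def)
  ultimately show ?thesis
    using that g_def by blast
qed

lemma cyclic_quotient_if_maximal_avoiding:
  assumes "prime p" "subspace L" "range ((*s) p) \<subseteq> L" "q \<notin> L"
    and maximal: "\<And>y. y \<notin> L \<Longrightarrow> q \<in> span (insert y L)"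
  shows "\<exists>j. y - j *s q \<in> L"
proof (cases "y \<in> L")
  case True
  then show ?thesis by (intro exI[of _ 0]) simp
next
  case False
  then obtain c where c: "q - c *s y \<in> L"
    using maximal span_breakdown_eq span_eq_iff assms(2) by metis
  have "\<not> p dvd c"
  proof
    assume "p dvd c"
    then have "c *s y \<in> L"
      using assms(3) by (metis dvdE rangeI scale_scale subsetD)
    then show False
      using c assms(2,4) subspace_add by fastforce
  qed
  then obtain u v where uv: "u * p + v * c = 1"
    using assms(1) prime_imp_coprime bezout_int by (metis coprime_iff_gcd_eq_1)
  have "y - v *s q = u *s (p *s y) - v *s (q - c *s y)"
    using arg_cong[OF uv, of "\<lambda>a. a *s y"]
    by (simp add: scale_left_distrib scale_right_diff_distrib algebra_simps)
  also have "\<dots> \<in> L"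
    using assms(2,3) c by (metis rangeI subsetD subspace_diff subspace_scale)
  finally show ?thesis ..
qed

lemma range_central_subset_range_scale:
  assumes "prime p" "p *s t = 0" "t \<noteq> 0" "endo_central scale z" "z t = 0"
  shows "z y \<in> range ((*s) p)"
proof (rule ccontr)
  define q where "q = z y"
  assume "q \<notin> range ((*s) p)"
  then have avoid: "range ((*s) p) \<inter> {q} \<subseteq> {}"
    by blast
  have "subspace (range ((*s) p))"
    using module_hom.subspace_image[OF module_hom_scale_self subspace_UNIV] by simp
  obtain L where L: "subspace L" "range ((*s) p) \<subseteq> L" "L \<inter> {q} \<subseteq> {}"
    and maximal: "\<And>y. y \<notin> L \<Longrightarrow> \<not> span (insert y L) \<inter> {q} \<subseteq> {}"
    using exists_maximal_subspace[OF \<open>subspace (range ((*s) p))\<close> avoid] by blast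
  have "q \<notin> L"
    using L(3) by blast
  have cyclic: "\<exists>j. y - j *s q \<in> L" for y
    using cyclic_quotient_if_maximal_avoiding[OF assms(1) L(1,2) \<open>q \<notin> L\<close>] maximal by blast
  have ann: "j *s t = 0" if "j *s q \<in> L" for j
  proof -
    have "p *s q \<in> L"
      using L(2) by blast
    then have "p dvd j"
      using mem_subspace_if_coprime_scales[OF L(1) prime_imp_coprime[OF assms(1)]]
        \<open>q \<notin> L\<close> that by blast
    then obtain k where "j = k * p"
      by (metis dvdE mult.commute)
    then show ?thesis
      using assms(2) by (simp flip: scale_scale)
  qed
  obtain g where g: "g \<in> endo scale" "g q = t" "\<And>y. \<exists>j. g y = j *s t"
    using exists_endo_of_cyclic_quotient[OF L(1) cyclic ann] by blast
  obtain j where "g y = j *s t"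
    using g(3) by blast
  have "t = g (z y)"
    using g(2) q_def by simp
  also have "\<dots> = z (g y)"
    using assms(4) g(1) unfolding endo_central_def by (metis comp_apply)
  also have "\<dots> = j *s z t"
    using \<open>g y = j *s t\<close> assms(4) module_hom.scale[of scale scale z]
    unfolding endo_central_def endo_def by simp
  finally show False
    using assms(3,5) by simp
qed

lemma nakayama:
  assumes "finite G" "subspace L" "\<And>x. x \<in> G \<Longrightarrow> \<exists>y\<in>span G. x - p *s y \<in> L"
  shows "\<exists>a. p dvd a - 1 \<and> (\<forall>x\<in>span G. a *s x \<in> L)"
  using assms
proof (induction G arbitrary: L rule: finite_induct)
  case empty
  then show ?case
    using subspace_0 by (intro exI[of _ 1]) auto
next
  case (insert g G)
  define L' where "L' = span (insert g L)"
  have span_L: "span L = L"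
    using insert.prems(1) by simp
  have "L \<subseteq> L'"
    unfolding L'_def by (meson span_superset subset_insertI subset_trans)
  have "\<exists>y\<in>span G. x - p *s y \<in> L'" if x: "x \<in> G" for x
  proof -
    obtain y where y: "y \<in> span (insert g G)" "x - p *s y \<in> L"
      using insert.prems(2) x by blast
    then obtain c where c: "y - c *s g \<in> span G"
      using span_breakdown_eq by blast
    have "x - p *s (y - c *s g) = (x - p *s y) + (p * c) *s g"
      by (simp add: algebra_simps scale_right_diff_distrib)
    also have "\<dots> \<in> L'"
      using y(2) \<open>L \<subseteq> L'\<close> unfolding L'_def
      by (meson span_add span_base span_scale insertI1 subsetD)
    finally show ?thesis
      using c by blast
  qed
  then obtain a where a: "p dvd a - 1" "\<And>x. x \<in> span G \<Longrightarrow> a *s x \<in> L'"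
    using insert.IH[of L'] unfolding L'_def by auto
  obtain y where y: "y \<in> span (insert g G)" "g - p *s y \<in> L"
    using insert.prems(2) by blast
  then obtain c where c: "y - c *s g \<in> span G"
    using span_breakdown_eq by blast
  obtain d where d: "a *s (y - c *s g) - d *s g \<in> L"
    using a(2)[OF c] span_breakdown_eq span_L unfolding L'_def by metis
  define b where "b = a - p * (d + a * c)"
  have "b *s g = a *s (g - p *s y) + p *s (a *s (y - c *s g) - d *s g)"
    unfolding b_def by (simp add: algebra_simps scale_right_diff_distrib scale_left_diff_distrib)
  then have bg: "b *s g \<in> L"
    using y(2) d insert.prems(1) by (metis subspace_add subspace_scale)
  have "(b * a) *s x \<in> L" if x: "x \<in> span (insert g G)" for x
  proof -
    obtain c' where c': "x - c' *s g \<in> span G"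
      using x span_breakdown_eq by blast
    obtain e where e: "a *s (x - c' *s g) - e *s g \<in> L"
      using a(2)[OF c'] span_breakdown_eq span_L unfolding L'_def by metis
    have "(b * a) *s x = b *s (a *s (x - c' *s g) - e *s g) + (e + a * c') *s (b *s g)"
      by (simp add: algebra_simps scale_right_diff_distrib)
    then show ?thesis
      using e bg insert.prems(1) by (metis subspace_add subspace_scale)
  qed
  moreover have "p dvd b * a - 1"
  proof -
    have "b * a - 1 = (a - 1) * (a + 1) - p * (d + a * c) * a"
      unfolding b_def by (simp add: algebra_simps)
    then show ?thesis
      using a(1) by simp
  qed
  ultimately show ?case
    by blast
qed

lemma fully_invariant_kernel_scale: "fully_invariant scale {y. n *s y = 0}"
proof -
  have "n *s f y = 0" if "f \<in> endo scale" "n *s y = 0" for f y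
    using that module_hom.scale[of scale scale f n y] module_hom.zero[of scale scale f]
    unfolding endo_def by simp
  then show ?thesis
    unfolding fully_invariant_def
    using module_hom.subspace_kernel[OF module_hom_scale_self] by (simp add: image_subset_iff)
qed

lemma centrally_endo_AIP_scale_unit:
  assumes "centrally_endo_AIP scale"
  obtains z where "endo_central scale z" "\<And>y. n *s y = 0 \<Longrightarrow> z y = 0" "\<And>y. n *s z y = n *s y"
proof -
  have "centrally_s_unital scale (lann scale {y. n *s y = 0})"
    using assms fully_invariant_kernel_scale unfolding centrally_endo_AIP_def by blast
  moreover have "(\<lambda>y. n *s y) \<in> lann scale {y. n *s y = 0}"
    unfolding lann_def endo_def by simp
  ultimately obtain z where z: "z \<in> lann scale {y. n *s y = 0}" "endo_central scale z"
      "(\<lambda>y. n *s y) \<circ> z = (\<lambda>y. n *s y)"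
    unfolding centrally_s_unital_def by blast
  have "z y = 0" if "n *s y = 0" for y
    using z(1) that unfolding lann_def by blast
  moreover have "n *s z y = n *s y" for y
    using fun_cong[OF z(3), of y] by simp
  ultimately show ?thesis
    using that z(2) by blast
qed

lemma centrally_endo_AIP_square_annihilator:
  assumes "centrally_endo_AIP scale" "(n * n) *s x = 0"
  shows "n *s x = 0"
proof -
  obtain z where z: "endo_central scale z" "\<And>y. n *s y = 0 \<Longrightarrow> z y = 0" "\<And>y. n *s z y = n *s y"
    using centrally_endo_AIP_scale_unit[OF assms(1)] by blast
  have "n *s x = n *s z x"
    using z(3) by simp
  also have "\<dots> = z (n *s x)"
    using z(1) module_hom.scale[of scale scale z] unfolding endo_central_def endo_def by simp
  also have "\<dots> = 0"
    using z(2) assms(2) by simp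
  finally show ?thesis .
qed

lemma nakayama_idempotent_range:
  assumes "fin_gen scale" "module_hom scale scale z" "\<And>y. z (z y) = z y"
    and "\<And>y. z y \<in> range ((*s) p)"
  obtains a where "p dvd a - 1" "\<And>y. a *s z y = 0"
proof -
  obtain F where F: "finite F" "span F = UNIV"
    using assms(1) unfolding fin_gen_def by blast
  have span_zF: "span (z ` F) = range z"
    using module_hom.span_image[OF assms(2)] F(2) by simp
  have divisible: "\<exists>y\<in>span (z ` F). x - p *s y \<in> {0}" if x: "x \<in> z ` F" for x
  proof -
    obtain x\<^sub>0 where x\<^sub>0: "x = z x\<^sub>0"
      using x by blast
    then obtain y where "x = p *s y"
      using assms(4) by blast
    then have "x = p *s z y"
      using x\<^sub>0 assms(3) module_hom.scale[OF assms(2)] by metis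
    then show ?thesis
      using span_zF by auto
  qed
  show ?thesis
    using nakayama[OF finite_imageI[OF F(1)] subspace_single_0 divisible] span_zF that by auto
qed

lemma centrally_endo_AIP_bounded_exponent:
  assumes "fin_gen scale" "centrally_endo_AIP scale" "prime p" "t \<noteq> 0" "p *s t = 0"
  shows "\<exists>n. n \<noteq> 0 \<and> (\<forall>w. n *s w = 0)"
proof -
  obtain z where z: "endo_central scale z" "\<And>y. p *s y = 0 \<Longrightarrow> z y = 0" "\<And>y. p *s z y = p *s y"
    using centrally_endo_AIP_scale_unit[OF assms(2)] by blast
  have hom: "module_hom scale scale z"
    using z(1) unfolding endo_central_def endo_def by simp
  have "z (z y) = z y" for y
  proof -
    have "p *s (z y - y) = 0"
      using z(3) by (simp add: scale_right_diff_distrib)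
    then show ?thesis
      using z(2) module_hom.diff[OF hom] by fastforce
  qed
  then obtain a where a: "p dvd a - 1" "\<And>y. a *s z y = 0"
    using nakayama_idempotent_range[OF assms(1) hom]
      range_central_subset_range_scale[OF assms(3,5,4) z(1) z(2)[OF assms(5)]] by blast
  have "(p * a) *s w = 0" for w
  proof -
    have "(p * a) *s w = a *s (p *s z w)"
      using z(3) by (simp add: mult.commute)
    also have "\<dots> = p *s (a *s z w)"
      by (simp add: mult.commute)
    finally show ?thesis
      using a(2) by simp
  qed
  moreover have "a \<noteq> 0"
  proof
    assume "a = 0"
    then have "p dvd 1"
      using a(1) by simp
    then show False
      using assms(3) not_prime_unit by blast
  qed
  then have "p * a \<noteq> 0"
    using assms(3) by simp
  ultimately show ?thesis
    by blast
qed

lemma exists_prime_order_outside_subspace: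
  assumes reduced: "\<And>n x. (n * n) *s x = 0 \<Longrightarrow> n *s x = 0"
    and L: "subspace L"
  shows "n \<noteq> 0 \<Longrightarrow> n *s x = 0 \<Longrightarrow> x \<notin> L \<Longrightarrow> \<exists>p y. prime p \<and> y \<notin> L \<and> p *s y = 0"
proof (induction "nat \<bar>n\<bar>" arbitrary: n x rule: less_induct)
  case less
  have "\<bar>n\<bar> \<noteq> 1"
  proof
    assume "\<bar>n\<bar> = 1"
    then have "n * n = 1"
      by (metis abs_mult_self_eq mult_1)
    then have "x = n *s (n *s x)"
      by simp
    then show False
      using less.prems(2,3) subspace_0[OF L] by simp
  qed
  then obtain p m where p: "prime p" and n: "n = p * m"
    using prime_factor_int by (metis dvdE)
  have "m \<noteq> 0" "nat \<bar>m\<bar> < nat \<bar>n\<bar>"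
    using less.prems(1) n prime_gt_1_int[OF p] by (auto simp: abs_mult)
  show ?case
  proof (cases "p dvd m")
    case True
    \<comment> \<open>then p^2 divides n, and reducedness lowers the annihilator of x to m = n / p\<close>
    then obtain k where "m = p * k"
      by blast
    then have "((p * k) * (p * k)) *s x = 0"
      using less.prems(2) n by (metis mult.assoc mult.commute scale_scale scale_zero_right)
    then have "m *s x = 0"
      using reduced \<open>m = p * k\<close> by blast
    then show ?thesis
      using less.hyps \<open>m \<noteq> 0\<close> \<open>nat \<bar>m\<bar> < nat \<bar>n\<bar>\<close> less.prems(3) by blast
  next
    case False
    show ?thesis
    proof (cases "m *s x \<in> L")
      case True
      then have "p *s x \<notin> L"
        using mem_subspace_if_coprime_scales[OF L prime_imp_coprime[OF p False]] less.prems(3)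
        by blast
      moreover have "m *s (p *s x) = 0"
        using less.prems(2) n by (simp add: mult.commute)
      ultimately show ?thesis
        using less.hyps \<open>m \<noteq> 0\<close> \<open>nat \<bar>m\<bar> < nat \<bar>n\<bar>\<close> by blast
    next
      case False
      moreover have "p *s (m *s x) = 0"
        using less.prems(2) n by simp
      ultimately show ?thesis
        using p by blast
    qed
  qed
qed

lemma span_insert_prime_order_Int_trivial:
  assumes N: "subspace N" and K: "subspace K" "K \<inter> N \<subseteq> {0}"
    and "prime p" "p *s y = 0" "y \<notin> span (N \<union> K)"
  shows "span (insert y K) \<inter> N \<subseteq> {0}"
proof
  fix v assume v: "v \<in> span (insert y K) \<inter> N"
  then obtain j where "v - j *s y \<in> span K"
    using span_breakdown_eq by blast
  then have j: "v - j *s y \<in> K"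
    using K(1) by (simp add: span_eq_iff[THEN iffD2])
  show "v \<in> {0}"
  proof (cases "p dvd j")
    case True
    then obtain k where "j = p * k"
      by blast
    then have "j *s y = 0"
      using assms(5) by (simp flip: scale_scale add: mult.commute)
    then show ?thesis
      using v j K(2) by auto
  next
    case False
    have "j *s y = v - (v - j *s y)"
      by simp
    also have "\<dots> \<in> span (N \<union> K)"
      using v j by (meson IntD2 UnI1 UnI2 span_base span_diff)
    finally have "y \<in> span (N \<union> K)"
      using mem_subspace_if_coprime_scales[OF subspace_span prime_imp_coprime[OF assms(4) False]]
        assms(5) span_zero by simp
    then show ?thesis
      using assms(6) by blast
  qed
qed

lemma semisimple_if_torsion_reduced:
  assumes reduced: "\<And>n x. (n * n) *s x = 0 \<Longrightarrow> n *s x = 0"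
    and torsion: "\<And>x. \<exists>n. n \<noteq> 0 \<and> n *s x = 0"
  shows "semisimple scale"
  unfolding semisimple_def
proof (intro allI impI)
  fix N assume N: "subspace N"
  have avoid: "{0} \<inter> N \<subseteq> {0}"
    by blast
  obtain K where K: "subspace K" "K \<inter> N \<subseteq> {0}"
    and maximal: "\<And>y. y \<notin> K \<Longrightarrow> \<not> span (insert y K) \<inter> N \<subseteq> {0}"
    by (rule exists_maximal_subspace[OF subspace_single_0 avoid]) (rule that)
  have "x \<in> span (N \<union> K)" for x
  proof (rule ccontr)
    assume "x \<notin> span (N \<union> K)"
    moreover obtain n where "n \<noteq> 0" "n *s x = 0"
      using torsion by blast
    ultimately obtain p y where "prime p" "y \<notin> span (N \<union> K)" "p *s y = 0"
      using exists_prime_order_outside_subspace[OF reduced subspace_span] by blast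
    moreover from this have "y \<notin> K"
      using span_superset by blast
    ultimately show False
      using maximal span_insert_prime_order_Int_trivial[OF N K] by blast
  qed
  moreover have "span (N \<union> K) = {n + k | n k. n \<in> N \<and> k \<in> K}"
    unfolding span_Un using N K(1) by (simp add: span_eq_iff[THEN iffD2])
  moreover have "N \<inter> K = {0}"
    using K N subspace_0 by blast
  ultimately show "\<exists>K. subspace K \<and> N \<inter> K = {0} \<and> {n + k |n k. n \<in> N \<and> k \<in> K} = UNIV"
    using K(1) by blast
qed

end

theorem proposition2p9:
  fixes s :: "int \<Rightarrow> 'b::ab_group_add \<Rightarrow> 'b"
  assumes "module s"
    and "fin_gen s"
    and "centrally_endo_AIP s"
  shows "torsion_free s \<or> semisimple s"
proof -
  interpret int_module s
    using assms(1) unfolding int_module_def .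
  have reduced: "\<And>n x. s (n * n) x = 0 \<Longrightarrow> s n x = 0"
    using centrally_endo_AIP_square_annihilator[OF assms(3)] .
  show ?thesis
  proof (cases "torsion_free s")
    case False
    then obtain r x where "r \<noteq> 0" "s r x = 0" "x \<notin> {0}"
      unfolding torsion_free_def by blast
    then obtain p t where "prime p" "t \<notin> {0}" "s p t = 0"
      using exists_prime_order_outside_subspace[OF reduced subspace_single_0] by blast
    then obtain n where "n \<noteq> 0" "\<And>w. s n w = 0"
      using centrally_endo_AIP_bounded_exponent[OF assms(2,3)] by blast
    then show ?thesis
      using semisimple_if_torsion_reduced[OF reduced] by blast
  qed simp
qed

end
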